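(* Let $m, n$ be positive integers, let $V = (\mathbb{Z}/n\mathbb{Z})^{2m}$ be the free $\mathbb{Z}/n\mathbb{Z}$-module of rank $2m$, and let $W$ be a $\mathbb{Z}/n\mathbb{Z}$-submodule of $V$. Let $\Gamma$ be a subgroup of the symplectic group $Sp(2m, \mathbb{Z}/n\mathbb{Z})$ acting in an abelian way on $W$, i.e. $W$ is $\Gamma$-invariant and $(AB-BA)w = 0$ for all $A, B \in \Gamma$ and all $w \in W$. Let $I(\Gamma)$ be the index of $\Gamma$ in $Sp(2m, \mathbb{Z}/n\mathbb{Z})$. Then $$|W| \leq I(\Gamma)^{2+2m}\,\zeta(2)^{2+2m}.$$
   Context: $|W|$ denotes the cardinality of the finite set $W$. $Sp(2m,\mathbb{Z}/n\mathbb{Z})$ is the group of $2m\times 2m$ matrices $M$ over $\mathbb{Z}/n\mathbb{Z}$ with $M^{T}\Omega M = \Omega$, where $\Omega = \begin{pmatrix} 0 & I_m \\ -I_m & 0\end{pmatrix}$ and $I_m$ is the $m\times m$ identity matrix; it acts on $V=(\mathbb{Z}/n\mathbb{Z})^{2m}$ (column vectors) by matrix multiplication. $\zeta$ is the Riemann zeta function, so $\zeta(2)=\sum_{k\ge 1}k^{-2}=\pi^2/6$. *)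

theory Defs
  imports
    Complex_Main
    "HOL-Number_Theory.Residues"
    "Jordan_Normal_Form.Matrix"
begin

(* Elements of Z/nZ are represented by the integers 0, ..., n - 1.  The unit of residue_ring 1 is
   1, which lies outside its carrier {0}; reducing the unit gives the zero ring when n = 1 and
   leaves residue_ring n unchanged when n > 1. *)
definition zmod :: "nat \<Rightarrow> int ring" where
  "zmod n = (residue_ring (int n))\<lparr>one := 1 mod int n\<rparr>"

definition mat_mod :: "nat \<Rightarrow> int mat \<Rightarrow> int mat" where
  "mat_mod n A = map_mat (\<lambda>x. x mod int n) A"

definition vec_mod :: "nat \<Rightarrow> int vec \<Rightarrow> int vec" where
  "vec_mod n v = map_vec (\<lambda>x. x mod int n) v"

(* The multiplicative fields of a module record have no meaning and are left unspecified. *)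
definition zmod_vec :: "nat \<Rightarrow> nat \<Rightarrow> (int, int vec) module" where
  "zmod_vec n d =
    \<lparr>carrier = {v \<in> carrier_vec d. \<forall>i<d. v $ i \<in> carrier (zmod n)},
     monoid.mult = undefined,
     one = undefined,
     zero = 0\<^sub>v d,
     add = (\<lambda>u v. vec_mod n (u + v)),
     smult = (\<lambda>a v. vec_mod n (a \<cdot>\<^sub>v v))\<rparr>"

definition zmod_mats :: "nat \<Rightarrow> nat \<Rightarrow> int mat set" where
  "zmod_mats n d = {A \<in> carrier_mat d d. \<forall>i<d. \<forall>j<d. A $$ (i, j) \<in> carrier (zmod n)}"

definition symp_form :: "nat \<Rightarrow> int mat" where
  "symp_form m = four_block_mat (0\<^sub>m m m) (1\<^sub>m m) (- 1\<^sub>m m) (0\<^sub>m m m)"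

(* Sums and products are computed over the integers and then reduced; since reduction modulo n is
   a ring homomorphism, this is matrix arithmetic over Z/nZ. *)
definition symplectic_group :: "nat \<Rightarrow> nat \<Rightarrow> int mat monoid" where
  "symplectic_group m n =
    \<lparr>carrier = {M \<in> zmod_mats n (2 * m).
       mat_mod n (M\<^sup>T * symp_form m * M) = mat_mod n (symp_form m)},
     monoid.mult = (\<lambda>A B. mat_mod n (A * B)),
     one = mat_mod n (1\<^sub>m (2 * m))\<rparr>"

definition zmod_act :: "nat \<Rightarrow> int mat \<Rightarrow> int vec \<Rightarrow> int vec" where
  "zmod_act n A v = vec_mod n (A *\<^sub>v v)"

definition acts_abelian_on :: "nat \<Rightarrow> nat \<Rightarrow> int mat set \<Rightarrow> int vec set \<Rightarrow> bool" where
  "acts_abelian_on m n \<Gamma> W \<longleftrightarrow>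
     (\<forall>A\<in>\<Gamma>. \<forall>w\<in>W. zmod_act n A w \<in> W) \<and>
     (\<forall>A\<in>\<Gamma>. \<forall>B\<in>\<Gamma>. \<forall>w\<in>W. zmod_act n (A * B - B * A) w = 0\<^sub>v (2 * m))"

definition subgroup_index :: "('a, 'b) monoid_scheme \<Rightarrow> 'a set \<Rightarrow> nat" where
  "subgroup_index G H = card (rcosets\<^bsub>G\<^esub> H)"

(* The Dirichlet series of the Riemann zeta function, meant for real s > 1 only. *)
definition zeta :: "real \<Rightarrow> real" where
  "zeta s = (\<Sum>k. 1 / real (Suc k) powr s)"

lemma carrier_zmod: "carrier (zmod n) = {0..<int n}"
  by (auto simp: zmod_def residue_ring_def)

lemma zmod_simps:
  "\<zero>\<^bsub>zmod n\<^esub> = 0" "\<one>\<^bsub>zmod n\<^esub> = 1 mod int n"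
  "x \<oplus>\<^bsub>zmod n\<^esub> y = (x + y) mod int n" "x \<otimes>\<^bsub>zmod n\<^esub> y = x * y mod int n"
  by (simp_all add: zmod_def residue_ring_def)

lemma cring_zmod:
  assumes "n > 0"
  shows "cring (zmod n)"
proof (rule cringI)
  show "abelian_group (zmod n)"
  proof (rule abelian_groupI)
    fix x assume "x \<in> carrier (zmod n)"
    then show "\<exists>y\<in>carrier (zmod n). y \<oplus>\<^bsub>zmod n\<^esub> x = \<zero>\<^bsub>zmod n\<^esub>"
      using assms
      by (intro bexI[of _ "(- x) mod int n"]) (auto simp: carrier_zmod zmod_simps mod_simps)
  qed (use assms in \<open>auto simp: carrier_zmod zmod_simps mod_simps algebra_simps\<close>)
  show "comm_monoid (zmod n)"
    by (rule comm_monoidI)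
      (use assms in \<open>auto simp: carrier_zmod zmod_simps mod_simps algebra_simps\<close>)
qed (use assms in \<open>auto simp: carrier_zmod zmod_simps mod_simps algebra_simps\<close>)

lemma module_zmod_vec:
  assumes "n > 0"
  shows "module (zmod n) (zmod_vec n d)"
proof (rule moduleI)
  show "cring (zmod n)" using assms by (rule cring_zmod)
  show "abelian_group (zmod_vec n d)"
  proof (rule abelian_groupI)
    fix x assume "x \<in> carrier (zmod_vec n d)"
    then show "\<exists>y\<in>carrier (zmod_vec n d). y \<oplus>\<^bsub>zmod_vec n d\<^esub> x = \<zero>\<^bsub>zmod_vec n d\<^esub>"
      using assms
      by (intro bexI[of _ "vec_mod n (- x)"])
        (auto simp: zmod_vec_def vec_mod_def carrier_zmod mod_simps intro!: eq_vecI)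
  qed (use assms in
      \<open>auto simp: zmod_vec_def vec_mod_def carrier_zmod mod_simps algebra_simps intro!: eq_vecI\<close>)
qed (use assms in
    \<open>auto simp: zmod_vec_def vec_mod_def carrier_zmod zmod_simps mod_simps algebra_simps
      intro!: eq_vecI\<close>)

lemma finite_zmod_mats: "finite (zmod_mats n d)"
proof (rule finite_subset)
  let ?F = "({..<d} \<times> {..<d}) \<rightarrow>\<^sub>E {0..<int n}"
  show "zmod_mats n d \<subseteq> (\<lambda>f. mat d d f) ` ?F"
  proof
    fix A assume A: "A \<in> zmod_mats n d"
    show "A \<in> (\<lambda>f. mat d d f) ` ?F"
      by (rule image_eqI[of _ _ "restrict (\<lambda>ij. A $$ ij) ({..<d} \<times> {..<d})"])
        (use A in \<open>auto simp: zmod_mats_def carrier_zmod intro!: eq_matI\<close>)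
  qed
  show "finite ((\<lambda>f. mat d d f) ` ?F)"
    by (intro finite_imageI finite_PiE) auto
qed

lemma mat_mod_carrier [simp]: "mat_mod n A \<in> carrier_mat a b \<longleftrightarrow> A \<in> carrier_mat a b"
  by (auto simp: mat_mod_def)

lemma mat_mod_in_zmod_mats:
  "n > 0 \<Longrightarrow> A \<in> carrier_mat d d \<Longrightarrow> mat_mod n A \<in> zmod_mats n d"
  by (auto simp: zmod_mats_def carrier_zmod mat_mod_def)

lemma mat_mod_id: "A \<in> zmod_mats n d \<Longrightarrow> mat_mod n A = A"
  by (auto simp: zmod_mats_def carrier_zmod mat_mod_def intro!: eq_matI)

lemma sum_mod_cong:
  fixes f g :: "nat \<Rightarrow> int"
  assumes "\<And>k. k \<in> S \<Longrightarrow> f k mod c = g k mod c"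
  shows "sum f S mod c = sum g S mod c"
  by (metis (no_types, lifting) assms mod_sum_eq sum.cong)

lemma mat_mod_mult_left:
  assumes "A \<in> carrier_mat a b" "B \<in> carrier_mat b c"
  shows "mat_mod n (mat_mod n A * B) = mat_mod n (A * B)"
  using assms
  by (intro eq_matI) (auto simp: mat_mod_def scalar_prod_def mod_simps intro!: sum_mod_cong)

lemma mat_mod_mult_right:
  assumes "A \<in> carrier_mat a b" "B \<in> carrier_mat b c"
  shows "mat_mod n (A * mat_mod n B) = mat_mod n (A * B)"
  using assms
  by (intro eq_matI) (auto simp: mat_mod_def scalar_prod_def mod_simps intro!: sum_mod_cong)

lemma mat_mod_transpose: "(mat_mod n A)\<^sup>T = mat_mod n (A\<^sup>T)"
  by (intro eq_matI) (auto simp: mat_mod_def)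

lemma symp_form_carrier [simp]: "symp_form m \<in> carrier_mat (2 * m) (2 * m)"
  unfolding symp_form_def mult_2 by (intro four_block_carrier_mat) auto

lemma symp_form_square: "symp_form m * symp_form m = - 1\<^sub>m (2 * m)"
proof -
  have "symp_form m * symp_form m =
      four_block_mat (- 1\<^sub>m m) (0\<^sub>m m m) (0\<^sub>m m m) (- 1\<^sub>m m)"
    unfolding symp_form_def
    by (subst mult_four_block_mat[of _ m m _ m _ m _ _ m _ m]) auto
  also have "\<dots> = - 1\<^sub>m (2 * m)"
    by (intro eq_matI) (auto simp: four_block_mat_def)
  finally show ?thesis .
qed

lemma symplectic_groupD:
  assumes "A \<in> carrier (symplectic_group m n)"
  shows "A \<in> zmod_mats n (2 * m)" "A \<in> carrier_mat (2 * m) (2 * m)"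
    "mat_mod n (A\<^sup>T * symp_form m * A) = mat_mod n (symp_form m)"
  using assms by (auto simp: symplectic_group_def zmod_mats_def)

lemma symplectic_group_closed:
  assumes n: "n > 0"
    and A: "A \<in> carrier (symplectic_group m n)" and B: "B \<in> carrier (symplectic_group m n)"
  shows "mat_mod n (A * B) \<in> carrier (symplectic_group m n)"
proof -
  let ?d = "2 * m" and ?J = "symp_form m"
  note a = symplectic_groupD[OF A] and b = symplectic_groupD[OF B]
  have cA: "A \<in> carrier_mat ?d ?d" and cB: "B \<in> carrier_mat ?d ?d"
    and cJ: "?J \<in> carrier_mat ?d ?d"
    using a b by auto
  have tA: "A\<^sup>T \<in> carrier_mat ?d ?d" and tB: "B\<^sup>T \<in> carrier_mat ?d ?d"
    using cA cB by simp_all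
  note mc = mult_carrier_mat[of _ ?d ?d _ ?d] and assoc = assoc_mult_mat[of _ ?d ?d _ ?d _ ?d]
  define P where "P = A * B"
  define Q where "Q = A\<^sup>T * ?J * A"
  have cP: "P \<in> carrier_mat ?d ?d" unfolding P_def by (rule mc[OF cA cB])
  have cQ: "Q \<in> carrier_mat ?d ?d" unfolding Q_def by (rule mc[OF mc[OF tA cJ] cA])
  have tP: "P\<^sup>T \<in> carrier_mat ?d ?d" using cP by simp
  have rP: "mat_mod n (P\<^sup>T) \<in> carrier_mat ?d ?d" using tP by simp
  have "mat_mod n ((mat_mod n P)\<^sup>T * ?J * mat_mod n P) = mat_mod n (mat_mod n (P\<^sup>T) * ?J * P)"
    unfolding mat_mod_transpose by (rule mat_mod_mult_right[OF mc[OF rP cJ] cP])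
  also have "\<dots> = mat_mod n (P\<^sup>T * (?J * P))"
    unfolding assoc[OF rP cJ cP] by (rule mat_mod_mult_left[OF tP mc[OF cJ cP]])
  also have "P\<^sup>T * (?J * P) = B\<^sup>T * (Q * B)"
    unfolding P_def Q_def transpose_mult[OF cA cB]
      assoc[OF tB tA mc[OF cJ mc[OF cA cB]]] assoc[OF mc[OF tA cJ] cA cB]
      assoc[OF tA cJ mc[OF cA cB]] ..
  also have "mat_mod n (B\<^sup>T * (Q * B)) = mat_mod n (B\<^sup>T * mat_mod n (mat_mod n Q * B))"
    unfolding mat_mod_mult_left[OF cQ cB] mat_mod_mult_right[OF tB mc[OF cQ cB]] ..
  also have "mat_mod n Q = mat_mod n ?J"
    unfolding Q_def by (rule a(3))
  also have "mat_mod n (B\<^sup>T * mat_mod n (mat_mod n ?J * B)) = mat_mod n (B\<^sup>T * ?J * B)"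
    unfolding mat_mod_mult_left[OF cJ cB] mat_mod_mult_right[OF tB mc[OF cJ cB]]
      assoc[OF tB cJ cB] ..
  also have "\<dots> = mat_mod n ?J" by (rule b(3))
  finally show ?thesis
    using mat_mod_in_zmod_mats[OF n cP] by (simp add: symplectic_group_def P_def)
qed

lemma symplectic_group_one:
  assumes "n > 0"
  shows "mat_mod n (1\<^sub>m (2 * m)) \<in> carrier (symplectic_group m n)"
proof -
  let ?d = "2 * m" and ?J = "symp_form m"
  have "mat_mod n ((mat_mod n (1\<^sub>m ?d))\<^sup>T * ?J * mat_mod n (1\<^sub>m ?d)) =
      mat_mod n (mat_mod n (1\<^sub>m ?d) * ?J * 1\<^sub>m ?d)"
    by (subst mat_mod_mult_right[of _ ?d ?d _ ?d])
      (auto simp: mat_mod_transpose intro: mult_carrier_mat[of _ ?d ?d _ ?d])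
  also have "\<dots> = mat_mod n (mat_mod n (1\<^sub>m ?d) * ?J)"
    by (subst right_mult_one_mat[of _ ?d ?d]) (auto intro: mult_carrier_mat[of _ ?d ?d _ ?d])
  also have "\<dots> = mat_mod n ?J"
    by (subst mat_mod_mult_left[of _ ?d ?d _ ?d]) (auto simp: left_mult_one_mat[of _ ?d ?d])
  finally show ?thesis
    using assms by (auto simp: symplectic_group_def intro: mat_mod_in_zmod_mats)
qed

lemma symplectic_group_simps:
  "\<one>\<^bsub>symplectic_group m n\<^esub> = mat_mod n (1\<^sub>m (2 * m))"
  "A \<otimes>\<^bsub>symplectic_group m n\<^esub> B = mat_mod n (A * B)"
  by (simp_all add: symplectic_group_def)

lemma symplectic_group_left_cancel:
  assumes A: "A \<in> carrier (symplectic_group m n)"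
    and X: "X \<in> zmod_mats n (2 * m)" and Y: "Y \<in> zmod_mats n (2 * m)"
    and eq: "mat_mod n (A * X) = mat_mod n (A * Y)"
  shows "X = Y"
proof -
  let ?d = "2 * m" and ?J = "symp_form m"
  note a = symplectic_groupD[OF A]
  have c: "A \<in> carrier_mat ?d ?d" "A\<^sup>T \<in> carrier_mat ?d ?d" "?J \<in> carrier_mat ?d ?d"
    using a by auto
  have key: "mat_mod n (- (?J * (A\<^sup>T * ?J)) * mat_mod n (A * Z)) = Z"
    if Z: "Z \<in> zmod_mats n ?d" for Z
  proof -
    have z: "Z \<in> carrier_mat ?d ?d" using Z by (simp add: zmod_mats_def)
    have N: "- (?J * (A\<^sup>T * ?J)) = - ?J * (A\<^sup>T * ?J)"
      using c carrier_matD[OF c(3)] by (intro uminus_mult_left_mat[symmetric]) auto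
    have nj: "- ?J \<in> carrier_mat ?d ?d" by simp
    have "mat_mod n (- ?J * (A\<^sup>T * ?J) * mat_mod n (A * Z)) =
        mat_mod n (- ?J * (A\<^sup>T * ?J) * (A * Z))"
      using c z nj by (intro mat_mod_mult_right[of _ ?d ?d _ ?d])
        (auto intro!: mult_carrier_mat[of _ ?d ?d _ ?d])
    also have "- ?J * (A\<^sup>T * ?J) * (A * Z) = - ?J * ((A\<^sup>T * ?J * A) * Z)"
      using c z nj by (simp add: assoc_mult_mat[of _ ?d ?d _ ?d _ ?d]
          mult_carrier_mat[of _ ?d ?d _ ?d] del: uminus_carrier_iff_mat)
    also have "mat_mod n (- ?J * ((A\<^sup>T * ?J * A) * Z)) =
        mat_mod n (- ?J * mat_mod n (mat_mod n (A\<^sup>T * ?J * A) * Z))"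
      using c z nj by (simp add: mat_mod_mult_right[of _ ?d ?d _ ?d]
          mat_mod_mult_left[of _ ?d ?d _ ?d] mult_carrier_mat[of _ ?d ?d _ ?d]
          del: uminus_carrier_iff_mat)
    also have "\<dots> = mat_mod n (- ?J * (?J * Z))"
      using c z nj by (simp add: a(3) mat_mod_mult_right[of _ ?d ?d _ ?d]
          mat_mod_mult_left[of _ ?d ?d _ ?d] mult_carrier_mat[of _ ?d ?d _ ?d]
          del: uminus_carrier_iff_mat)
    also have "- ?J * (?J * Z) = (- ?J * ?J) * Z"
      using c z nj by (simp add: assoc_mult_mat[of _ ?d ?d _ ?d _ ?d]
          del: uminus_carrier_iff_mat)
    also have "- ?J * ?J = 1\<^sub>m ?d"
      using carrier_matD[OF c(3)] uminus_mult_left_mat[of ?J ?J]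
      by (simp only: symp_form_square uminus_uminus_mat)
    also have "1\<^sub>m ?d * Z = Z"
      using z by simp
    finally show ?thesis
      using mat_mod_id[OF Z] N by simp
  qed
  show ?thesis
    using key[OF X] unfolding eq key[OF Y] by (rule sym)
qed

lemma group_symplectic_group:
  assumes n: "n > 0"
  shows "group (symplectic_group m n)"
proof -
  let ?G = "symplectic_group m n" and ?d = "2 * m"
  note D = symplectic_groupD
  interpret monoid ?G
  proof (rule monoidI)
    fix A B C
    assume "A \<in> carrier ?G" "B \<in> carrier ?G" "C \<in> carrier ?G"
    then have "A \<in> carrier_mat ?d ?d" "B \<in> carrier_mat ?d ?d" "C \<in> carrier_mat ?d ?d"
      by (auto dest: D)
    then show "A \<otimes>\<^bsub>?G\<^esub> B \<otimes>\<^bsub>?G\<^esub> C = A \<otimes>\<^bsub>?G\<^esub> (B \<otimes>\<^bsub>?G\<^esub> C)"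
      by (simp add: symplectic_group_simps mat_mod_mult_right[of _ ?d ?d _ ?d]
          mat_mod_mult_left[of _ ?d ?d _ ?d] assoc_mult_mat[of _ ?d ?d _ ?d _ ?d]
          mult_carrier_mat[of _ ?d ?d _ ?d])
  next
    fix A assume A: "A \<in> carrier ?G"
    show "\<one>\<^bsub>?G\<^esub> \<otimes>\<^bsub>?G\<^esub> A = A" "A \<otimes>\<^bsub>?G\<^esub> \<one>\<^bsub>?G\<^esub> = A"
      using D[OF A] by (simp_all add: symplectic_group_simps mat_mod_mult_right[of _ ?d ?d _ ?d]
          mat_mod_mult_left[of _ ?d ?d _ ?d] mat_mod_id)
  qed (use n in \<open>auto simp: symplectic_group_simps symplectic_group_one symplectic_group_closed\<close>)
  have fin: "finite (carrier ?G)"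
    by (rule finite_subset[OF _ finite_zmod_mats[of n ?d]]) (auto dest: D)
  have right_inv: "\<exists>B\<in>carrier ?G. A \<otimes>\<^bsub>?G\<^esub> B = \<one>\<^bsub>?G\<^esub>" if A: "A \<in> carrier ?G" for A
  proof -
    have "inj_on (\<lambda>B. A \<otimes>\<^bsub>?G\<^esub> B) (carrier ?G)"
      by (rule inj_onI)
        (use A in \<open>auto simp: symplectic_group_simps
          intro: symplectic_group_left_cancel[OF A] dest: D(1)\<close>)
    moreover have "(\<lambda>B. A \<otimes>\<^bsub>?G\<^esub> B) ` carrier ?G \<subseteq> carrier ?G"
      using A by auto
    ultimately have "(\<lambda>B. A \<otimes>\<^bsub>?G\<^esub> B) ` carrier ?G = carrier ?G"
      using fin by (simp add: endo_inj_surj)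
    then show ?thesis
      by (metis (no_types, lifting) imageE one_closed)
  qed
  show ?thesis
  proof (rule group_l_invI)
    fix A assume A: "A \<in> carrier ?G"
    obtain B where B: "B \<in> carrier ?G" "A \<otimes>\<^bsub>?G\<^esub> B = \<one>\<^bsub>?G\<^esub>"
      using right_inv[OF A] by auto
    obtain C where C: "C \<in> carrier ?G" "B \<otimes>\<^bsub>?G\<^esub> C = \<one>\<^bsub>?G\<^esub>"
      using right_inv[OF B(1)] by auto
    have "A = C"
      using A B C by (metis m_assoc l_one r_one)
    then show "\<exists>B\<in>carrier ?G. B \<otimes>\<^bsub>?G\<^esub> A = \<one>\<^bsub>?G\<^esub>"
      using B C by auto
  qed
qed

end

(* The block matrices [[1, diag(s)], [0, 1]] form a copy of (Z/n)^m inside the symplectic group, and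
   so do their transposes.  Let d_i generate the ideal of all i-th entries s_i of the elements of
   this copy that lie in Gamma.  The vectors c with 0 <= c_i < d_i represent pairwise distinct
   cosets of Gamma, so that prod d_i <= I; define d'_i likewise for the transposed copy.  The
   additive commutator of an upper element diag(s) and a lower element diag(t) is diag(st, -st), so
   that the i-th and the (m+i)-th coordinate of every vector of W are killed by d_i d'_i and hence
   take at most d_i d'_i values.  Thus |W| <= (prod d_i d'_i)^2 <= I^4 <= I^(2 + 2m), and
   zeta(2) >= 1. *)
theory Submission
  imports Defs
begin

section \<open>Preliminaries on zeta(2), divisibility and subgroup indices\<close>

lemma summable_inverse_squares: "summable (\<lambda>k. 1 / real (Suc k) powr 2)"
proof (rule summable_comparison_test')
  \<comment> \<open>The telescoping majorant is 2 / ((k+1)(k+2)); the factor 2 comes from k + 2 <=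
    2(k + 1).\<close>
  show "summable (\<lambda>k. 2 * (1 / real (Suc k) - 1 / real (Suc (Suc k))))"
    by (intro summable_mult telescope_summable') (rule LIMSEQ_Suc[OF lim_1_over_n])
  fix k :: nat
  show "norm (1 / real (Suc k) powr 2) \<le> 2 * (1 / real (Suc k) - 1 / real (Suc (Suc k)))"
    by (simp add: divide_simps power2_eq_square)
qed

lemma zeta_2_ge_1: "zeta 2 \<ge> 1"
proof -
  have "(\<Sum>k<1. 1 / real (Suc k) powr 2) \<le> zeta 2"
    unfolding zeta_def using summable_inverse_squares by (rule sum_le_suminf) auto
  then show ?thesis by simp
qed

text \<open>The quotient \<open>k * x div n\<close> is exact and less than \<open>k\<close>, and it
  determines \<open>x\<close>. In the application \<open>k\<close> is a product of two divisors of
  \<open>n\<close> and may itself fail to divide \<open>n\<close>, so an inequality is the natural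
  form.\<close>

lemma card_annihilator_le:
  fixes k :: int
  assumes "n > 0" "k > 0"
  shows "card {x \<in> {0..<n}. n dvd k * x} \<le> nat k"
proof -
  have "inj_on (\<lambda>x. k * x div n) {x \<in> {0..<n}. n dvd k * x}"
  proof (rule inj_onI)
    fix x y assume "x \<in> {x \<in> {0..<n}. n dvd k * x}" "y \<in> {x \<in> {0..<n}. n dvd k * x}"
      and "k * x div n = k * y div n"
    then have "k * x = k * y" by (auto elim: dvd_div_eq_cancel)
    then show "x = y" using assms by simp
  qed
  moreover have "(\<lambda>x. k * x div n) ` {x \<in> {0..<n}. n dvd k * x} \<subseteq> {0..<k}"
  proof safe
    fix x assume x: "x \<in> {0..<n}" and "n dvd k * x"
    then have "n * (k * x div n) = k * x" by simp
    also have "\<dots> < n * k" using x assms by simp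
    finally have "k * x div n < k" using assms by simp
    then show "k * x div n \<in> {0..<k}"
      using x assms by (auto simp: pos_imp_zdiv_nonneg_iff)
  qed
  ultimately have "card {x \<in> {0..<n}. n dvd k * x} \<le> card {0..<k}"
    by (rule card_inj_on_le) simp
  then show ?thesis by simp
qed

text \<open>\<open>Gcd\<close> commutes with multiplication by a constant up to sign. Using this
  first for \<open>A\<close> with \<open>b\<close> fixed, then for \<open>B\<close>, passes from all
  products of elements to the product of the two generators.\<close>

lemma dvd_Gcd_mult_Gcd:
  fixes n x :: int
  assumes "\<And>a b. a \<in> A \<Longrightarrow> b \<in> B \<Longrightarrow> n dvd a * b * x"
  shows "n dvd Gcd A * Gcd B * x"
proof -
  have "n dvd b * x * Gcd A" if "b \<in> B" for b
  proof -
    have "n dvd Gcd ((*) (b * x) ` A)"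
      using assms[OF _ that] by (intro Gcd_greatest) (auto simp: ac_simps)
    then show ?thesis by (simp add: Gcd_mult)
  qed
  then have "n dvd Gcd ((*) (Gcd A * x) ` B)"
    by (intro Gcd_greatest) (auto simp: ac_simps)
  also have "Gcd ((*) (Gcd A * x) ` B) = normalize (Gcd A * x * Gcd B)"
    by (rule Gcd_mult)
  finally show ?thesis by (simp add: ac_simps)
qed

text \<open>\<open>G\<close> and \<open>T\<close> are abstract so that upper and lower unipotent
  matrices are treated together. Sequences have integer entries rather than residues, which makes
  \<open>T\<close> additive without any reduction; that \<open>T\<close> kills the constant sequence
  \<open>n\<close> forces each \<open>d i\<close> to divide \<open>n\<close>, hence to be
  nonzero.\<close>

lemma (in group) prod_Gcd_le_index:
  fixes T :: "(nat \<Rightarrow> int) \<Rightarrow> 'a" and n :: int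
  assumes fin: "finite (carrier G)" and H: "subgroup H G" and n: "n > 0"
    and closed: "\<And>s. T s \<in> carrier G"
    and add: "\<And>s t. T s \<otimes> T t = T (\<lambda>i. s i + t i)"
    and one: "T (\<lambda>i. n) = \<one>"
  defines "d \<equiv> \<lambda>i. Gcd {s i | s. T s \<in> H}"
  shows "d i > 0" and "(\<Prod>i<m. nat (d i)) \<le> subgroup_index G H"
proof -
  show pos: "d i > 0" for i
  proof -
    have "d i dvd n"
      unfolding d_def using subgroup.one_closed[OF H] one by (intro Gcd_dvd) auto
    moreover have "d i \<ge> 0" by (simp add: d_def)
    ultimately show ?thesis using n by (cases "d i = 0") auto
  qed
  let ?B = "\<lambda>i. {0..<d i}"
  have "inj_on (\<lambda>c. H #> T c) (Pi\<^sub>E {..<m} ?B)"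
  proof (rule inj_onI)
    fix c e assume c: "c \<in> Pi\<^sub>E {..<m} ?B" and e: "e \<in> Pi\<^sub>E {..<m} ?B"
      and eq: "H #> T c = H #> T e"
    have "T c \<in> H #> T e"
      using rcos_self[OF closed H, of c] eq by simp
    then obtain h where h: "h \<in> H" "T c = h \<otimes> T e"
      by (auto simp: r_coset_def)
    \<comment> \<open>Cancelling \<open>T e\<close> will place \<open>T\<close> of the difference in
      \<open>H\<close>, so that each \<open>c i - e i\<close> is one of the integers whose gcd is
      \<open>d i\<close>.\<close>
    have "T (\<lambda>i. c i - e i) \<otimes> T e = h \<otimes> T e"
      using h by (simp add: add)
    then have "T (\<lambda>i. c i - e i) = h"
      using h(1) subgroup.mem_carrier[OF H] closed by simp
    then have "d i dvd c i - e i" for i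
      unfolding d_def using h(1) by (intro Gcd_dvd) auto
    then have mod: "c i mod d i = e i mod d i" for i
      by (simp add: mod_eq_dvd_iff)
    have "c i = e i" if "i < m" for i
    proof -
      have "c i \<in> {0..<d i}" "e i \<in> {0..<d i}"
        using PiE_mem[OF c] PiE_mem[OF e] that by auto
      then show ?thesis using mod[of i] by simp
    qed
    then show "c = e"
      using c e by (intro PiE_ext) auto
  qed
  then have "card (Pi\<^sub>E {..<m} ?B) \<le> card (rcosets H)"
  proof (rule card_inj_on_le)
    show "(\<lambda>c. H #> T c) ` Pi\<^sub>E {..<m} ?B \<subseteq> rcosets H"
      using closed by (auto simp: RCOSETS_def)
    \<comment> \<open>An infinite set has \<open>card\<close> 0, so without finiteness the injection
      would bound nothing.\<close>
    show "finite (rcosets H)"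
      using fin by (simp add: RCOSETS_def)
  qed
  then show "(\<Prod>i<m. nat (d i)) \<le> subgroup_index G H"
    by (simp add: card_PiE subgroup_index_def)
qed

section \<open>Unipotent block matrices over the integers\<close>

definition upper_unip :: "nat \<Rightarrow> (nat \<Rightarrow> int) \<Rightarrow> int mat" where
  "upper_unip m s = four_block_mat (1\<^sub>m m) (mat_diag m s) (0\<^sub>m m m) (1\<^sub>m m)"

definition lower_unip :: "nat \<Rightarrow> (nat \<Rightarrow> int) \<Rightarrow> int mat" where
  "lower_unip m s = four_block_mat (1\<^sub>m m) (0\<^sub>m m m) (mat_diag m s) (1\<^sub>m m)"

lemma upper_unip_carrier [simp]: "upper_unip m s \<in> carrier_mat (2 * m) (2 * m)"
  unfolding upper_unip_def mult_2 by (intro four_block_carrier_mat) auto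

lemma lower_unip_carrier [simp]: "lower_unip m s \<in> carrier_mat (2 * m) (2 * m)"
  unfolding lower_unip_def mult_2 by (intro four_block_carrier_mat) auto

lemma transpose_mat_diag [simp]: "(mat_diag m s)\<^sup>T = mat_diag m s"
  by (intro eq_matI) (auto simp: mat_diag_def)

lemma mat_diag_add: "mat_diag m s + mat_diag m t = mat_diag m (\<lambda>i. s i + t i :: int)"
  by (intro eq_matI) (auto simp: mat_diag_def)

lemma transpose_upper_unip: "(upper_unip m s)\<^sup>T = lower_unip m s"
  unfolding upper_unip_def lower_unip_def
  by (subst transpose_four_block_mat[of _ m m _ m _ m]) auto

lemma transpose_lower_unip: "(lower_unip m s)\<^sup>T = upper_unip m s"
  by (simp flip: transpose_upper_unip)

text \<open>The equations alone do not determine the dimensions in their carrier premises; fixing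
  all blocks as \<open>m\<close> by \<open>m\<close> makes them usable for rewriting.\<close>

lemmas block_mat_simps = mult_four_block_mat[of _ m m _ m _ m _ _ m _ m]
  left_mult_one_mat[of _ m m] right_mult_one_mat[of _ m m]
  left_mult_zero_mat[of _ m m m] right_mult_zero_mat[of _ m m m]
  left_add_zero_mat[of _ m m] right_add_zero_mat[of _ m m] for m

lemma upper_unip_mult: "upper_unip m s * upper_unip m t = upper_unip m (\<lambda>i. s i + t i)"
  unfolding upper_unip_def by (simp add: block_mat_simps[where m = m] mat_diag_add add.commute)

lemma lower_unip_mult: "lower_unip m s * lower_unip m t = lower_unip m (\<lambda>i. s i + t i)"
  unfolding lower_unip_def by (simp add: block_mat_simps[where m = m] mat_diag_add)

lemma neg_one_mult_mat:
  fixes A :: "int mat"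
  assumes "A \<in> carrier_mat m m"
  shows "- 1\<^sub>m m * A = - A"
  using assms uminus_mult_left_mat[of "1\<^sub>m m" A] by simp

lemma mult_neg_one_mat:
  fixes A :: "int mat"
  assumes "A \<in> carrier_mat m m"
  shows "A * - 1\<^sub>m m = - A"
  using assms uminus_mult_right_mat[of A "1\<^sub>m m"] by simp

lemma uminus_zero_mat: "- 0\<^sub>m a b = (0\<^sub>m a b :: int mat)"
  by (intro eq_matI) auto

text \<open>The only block that could differ from the form is the lower right one; it is the
  diagonal block minus its transpose, which vanishes by symmetry.\<close>

lemma upper_unip_symp: "(upper_unip m s)\<^sup>T * symp_form m * upper_unip m s = symp_form m"
  unfolding transpose_upper_unip unfolding upper_unip_def lower_unip_def symp_form_def
  by (simp add: block_mat_simps[where m = m] mult_neg_one_mat[of _ m] neg_one_mult_mat[of _ m]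
      uminus_l_inv_mat[of _ m m] uminus_zero_mat)

lemma lower_unip_symp: "(lower_unip m s)\<^sup>T * symp_form m * lower_unip m s = symp_form m"
  unfolding transpose_lower_unip unfolding upper_unip_def lower_unip_def symp_form_def
  by (simp add: block_mat_simps[where m = m] mult_neg_one_mat[of _ m] neg_one_mult_mat[of _ m]
      uminus_l_inv_mat[of _ m m] uminus_zero_mat)

text \<open>Both products have the same off-diagonal blocks, so the difference is diagonal and
  constrains each coordinate of a vector separately.\<close>

lemma unip_commutator:
  "upper_unip m s * lower_unip m t - lower_unip m t * upper_unip m s =
    mat_diag (2 * m) (\<lambda>i. if i < m then s i * t i else - (s (i - m) * t (i - m)))"
proof -
  have "upper_unip m s * lower_unip m t =
      four_block_mat (1\<^sub>m m + mat_diag m (\<lambda>i. s i * t i)) (mat_diag m s) (mat_diag m t) (1\<^sub>m m)"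
    unfolding upper_unip_def lower_unip_def by (simp add: block_mat_simps[where m = m])
  moreover have "lower_unip m t * upper_unip m s =
      four_block_mat (1\<^sub>m m) (mat_diag m s) (mat_diag m t) (mat_diag m (\<lambda>i. t i * s i) + 1\<^sub>m m)"
    unfolding upper_unip_def lower_unip_def by (simp add: block_mat_simps[where m = m])
  ultimately show ?thesis
    by (intro eq_matI) (auto simp: mat_diag_def)
qed

section \<open>Reduction modulo n and the action on vectors\<close>

lemma mat_mod_in_symplectic_group:
  assumes n: "n > 0" and A: "A \<in> carrier_mat (2 * m) (2 * m)"
    and symp: "A\<^sup>T * symp_form m * A = symp_form m"
  shows "mat_mod n A \<in> carrier (symplectic_group m n)"
proof -
  let ?d = "2 * m" and ?J = "symp_form m"
  have c: "A\<^sup>T \<in> carrier_mat ?d ?d" "?J \<in> carrier_mat ?d ?d" using A by auto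
  note mc = mult_carrier_mat[of _ ?d ?d _ ?d]
  have "mat_mod n ((mat_mod n A)\<^sup>T * ?J * mat_mod n A) = mat_mod n (mat_mod n (A\<^sup>T) * ?J * A)"
    unfolding mat_mod_transpose using A c
    by (intro mat_mod_mult_right[of _ ?d ?d _ ?d] mc) auto
  also have "\<dots> = mat_mod n (mat_mod n (A\<^sup>T) * (?J * A))"
    using A c by (subst assoc_mult_mat[of _ ?d ?d _ ?d _ ?d]) auto
  also have "\<dots> = mat_mod n (A\<^sup>T * (?J * A))"
    using A c by (intro mat_mod_mult_left[of _ ?d ?d _ ?d] mc) auto
  also have "\<dots> = mat_mod n ?J"
    using A c symp by (subst assoc_mult_mat[of _ ?d ?d _ ?d _ ?d, symmetric]) auto
  finally show ?thesis
    using mat_mod_in_zmod_mats[OF n A] by (simp add: symplectic_group_def)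
qed

text \<open>These are the premises of \<open>prod_Gcd_le_index\<close>, alternating between the
  upper and the lower family. The last two hold because a diagonal block with entries
  \<open>n\<close> vanishes modulo \<open>n\<close>.\<close>

lemma mat_mod_unip_simps:
  assumes "n > 0"
  shows "mat_mod n (upper_unip m s) \<in> carrier (symplectic_group m n)"
    and "mat_mod n (lower_unip m s) \<in> carrier (symplectic_group m n)"
    and "mat_mod n (upper_unip m s) \<otimes>\<^bsub>symplectic_group m n\<^esub> mat_mod n (upper_unip m t) =
      mat_mod n (upper_unip m (\<lambda>i. s i + t i))"
    and "mat_mod n (lower_unip m s) \<otimes>\<^bsub>symplectic_group m n\<^esub> mat_mod n (lower_unip m t) =
      mat_mod n (lower_unip m (\<lambda>i. s i + t i))"
    and "mat_mod n (upper_unip m (\<lambda>i. int n)) = \<one>\<^bsub>symplectic_group m n\<^esub>"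
    and "mat_mod n (lower_unip m (\<lambda>i. int n)) = \<one>\<^bsub>symplectic_group m n\<^esub>"
proof -
  show "mat_mod n (upper_unip m s) \<in> carrier (symplectic_group m n)"
    "mat_mod n (lower_unip m s) \<in> carrier (symplectic_group m n)"
    using assms by (auto intro!: mat_mod_in_symplectic_group simp: upper_unip_symp lower_unip_symp)
  show "mat_mod n (upper_unip m s) \<otimes>\<^bsub>symplectic_group m n\<^esub> mat_mod n (upper_unip m t) =
      mat_mod n (upper_unip m (\<lambda>i. s i + t i))"
    "mat_mod n (lower_unip m s) \<otimes>\<^bsub>symplectic_group m n\<^esub> mat_mod n (lower_unip m t) =
      mat_mod n (lower_unip m (\<lambda>i. s i + t i))"
    by (simp_all add: symplectic_group_simps mat_mod_mult_left[of _ "2 * m" "2 * m" _ "2 * m"]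
        mat_mod_mult_right[of _ "2 * m" "2 * m" _ "2 * m"] upper_unip_mult lower_unip_mult)
  show "mat_mod n (upper_unip m (\<lambda>i. int n)) = \<one>\<^bsub>symplectic_group m n\<^esub>"
    "mat_mod n (lower_unip m (\<lambda>i. int n)) = \<one>\<^bsub>symplectic_group m n\<^esub>"
    by (auto simp: symplectic_group_simps mat_mod_def upper_unip_def lower_unip_def mat_diag_def)
qed

lemma mat_mod_diff:
  assumes "A \<in> carrier_mat a b" "B \<in> carrier_mat a b"
  shows "mat_mod n (mat_mod n A - mat_mod n B) = mat_mod n (A - B)"
  using assms by (intro eq_matI) (auto simp: mat_mod_def mod_simps)

lemma zmod_act_mat_mod:
  assumes "A \<in> carrier_mat a b" "v \<in> carrier_vec b"
  shows "zmod_act n (mat_mod n A) v = zmod_act n A v"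
  using assms
  by (intro eq_vecI)
    (auto simp: zmod_act_def vec_mod_def mat_mod_def scalar_prod_def mod_simps intro!: sum_mod_cong)

lemma mat_diag_mult_vec_index:
  fixes f :: "nat \<Rightarrow> int"
  assumes "v \<in> carrier_vec d" "i < d"
  shows "(mat_diag d f *\<^sub>v v) $ i = f i * v $ i"
  using assms
  by (simp add: mat_diag_def scalar_prod_def if_distrib[of "\<lambda>x. x * _"] cong: if_cong)

text \<open>Coordinates \<open>i\<close> and \<open>m + i\<close> meet the same diagonal entry up to
  sign, which divisibility ignores; \<open>i mod m\<close> therefore serves both halves.\<close>

lemma zmod_act_unip_commutator:
  assumes v: "v \<in> carrier_vec (2 * m)"
    and comm: "zmod_act n (mat_mod n (upper_unip m s) * mat_mod n (lower_unip m t) -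
      mat_mod n (lower_unip m t) * mat_mod n (upper_unip m s)) v = 0\<^sub>v (2 * m)"
    and i: "i < 2 * m"
  shows "int n dvd s (i mod m) * t (i mod m) * v $ i"
proof -
  let ?d = "2 * m" and ?U = "upper_unip m s" and ?L = "lower_unip m t"
  let ?f = "\<lambda>i. if i < m then s i * t i else - (s (i - m) * t (i - m))"
  let ?C = "mat_mod n ?U * mat_mod n ?L - mat_mod n ?L * mat_mod n ?U"
  note mc = mult_carrier_mat[of _ ?d ?d _ ?d]
  have C: "?C \<in> carrier_mat ?d ?d" by (intro minus_carrier_mat mc) auto
  \<comment> \<open>The action sees a matrix only modulo \<open>n\<close>, so the commutator of the
    reduced matrices can be replaced by the integer commutator.\<close>
  have "mat_mod n ?C = mat_mod n (mat_mod n (mat_mod n ?U * mat_mod n ?L) -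
      mat_mod n (mat_mod n ?L * mat_mod n ?U))"
    by (rule mat_mod_diff[symmetric, of _ ?d ?d]) (auto intro!: mc)
  also have "\<dots> = mat_mod n (mat_mod n (?U * ?L) - mat_mod n (?L * ?U))"
    by (simp add: mat_mod_mult_left[of _ ?d ?d _ ?d] mat_mod_mult_right[of _ ?d ?d _ ?d])
  also have "\<dots> = mat_mod n (?U * ?L - ?L * ?U)"
    by (rule mat_mod_diff[of _ ?d ?d]) (auto intro!: mc)
  also have "\<dots> = mat_mod n (mat_diag ?d ?f)"
    by (simp only: unip_commutator)
  finally have "zmod_act n (mat_diag ?d ?f) v = 0\<^sub>v ?d"
    using comm zmod_act_mat_mod[OF C v, of n] zmod_act_mat_mod[OF mat_diag_dim v, of n ?f]
    by simp
  then have "zmod_act n (mat_diag ?d ?f) v $ i = 0"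
    using i by simp
  then have "int n dvd ?f i * v $ i"
    using i mat_diag_mult_vec_index[OF v i, of ?f]
    by (simp add: zmod_act_def vec_mod_def mod_eq_0_iff_dvd carrier_matD[OF mat_diag_dim])
  moreover have "i mod m = (if i < m then i else i - m)"
    using i by (simp add: mod_if)
  ultimately show ?thesis by (simp split: if_splits)
qed

section \<open>Combining the coordinate bounds\<close>

lemma prod_mod_double:
  fixes f :: "nat \<Rightarrow> nat"
  shows "(\<Prod>i<2 * m. f (i mod m)) = (\<Prod>i<m. f i) ^ 2"
proof -
  have "(\<Prod>i<2 * m. f (i mod m)) = (\<Prod>i<m. f (i mod m)) * (\<Prod>i=m..<2 * m. f (i mod m))"
    by (simp only: lessThan_atLeast0) (rule prod.atLeastLessThan_concat[symmetric]; simp)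
  also have "(\<Prod>i=m..<2 * m. f (i mod m)) = (\<Prod>i<m. f ((i + m) mod m))"
    using prod.shift_bounds_nat_ivl[of "\<lambda>i. f (i mod m)" 0 m m]
    by (simp add: lessThan_atLeast0 mult_2)
  finally show ?thesis by (simp add: power2_eq_square)
qed

theorem theorem1p2:
  fixes m n :: nat and W :: "int Matrix.vec set" and \<Gamma> :: "int mat set"
  assumes "m > 0" and "n > 0"
    and "submodule W (zmod n) (zmod_vec n (2 * m))"
    and "subgroup \<Gamma> (symplectic_group m n)"
    and "acts_abelian_on m n \<Gamma> W"
  shows "real (card W) \<le>
    real (subgroup_index (symplectic_group m n) \<Gamma>) ^ (2 + 2 * m) * zeta 2 ^ (2 + 2 * m)"
proof -
  let ?G = "symplectic_group m n"
  define I where "I = subgroup_index ?G \<Gamma>"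
  \<comment> \<open>\<open>Gcd (S i)\<close> and \<open>Gcd (T i)\<close> are d_i and d'_i; the sets
    have the shape used in \<open>prod_Gcd_le_index\<close>, so its conclusions fold to
    them.\<close>
  define S where "S i = {s i | s. mat_mod n (upper_unip m s) \<in> \<Gamma>}" for i
  define T where "T i = {t i | t. mat_mod n (lower_unip m t) \<in> \<Gamma>}" for i
  interpret group ?G using assms(2) by (rule group_symplectic_group)
  have fin: "finite (carrier ?G)"
    by (rule finite_subset[OF _ finite_zmod_mats[of n "2 * m"]]) (auto dest: symplectic_groupD)
  note unip = mat_mod_unip_simps[OF assms(2)]
  have n: "int n > 0" using assms(2) by simp
  note S_index = prod_Gcd_le_index[where T = "\<lambda>s. mat_mod n (upper_unip m s)",
      OF fin assms(4) n unip(1,3,5), folded S_def I_def]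
  note T_index = prod_Gcd_le_index[where T = "\<lambda>t. mat_mod n (lower_unip m t)",
      OF fin assms(4) n unip(2,4,6), folded T_def I_def]
  define k where "k i = Gcd (S i) * Gcd (T i)" for i
  define K where "K i = {x \<in> {0..<int n}. int n dvd k (i mod m) * x}" for i
  have k_pos: "k i > 0" for i
    using S_index(1) T_index(1) by (simp add: k_def)
  have W: "v \<in> carrier_vec (2 * m)" "v $ i \<in> K i" if v: "v \<in> W" and i: "i < 2 * m" for v i
  proof -
    have "v \<in> carrier (zmod_vec n (2 * m))"
      using subgroup.subset[OF submodule.axioms(1)[OF assms(3)]] v by auto
    then show c: "v \<in> carrier_vec (2 * m)"
      by (simp add: zmod_vec_def)
    have "v $ i \<in> {0..<int n}"
      using \<open>v \<in> carrier (zmod_vec n (2 * m))\<close> i by (simp add: zmod_vec_def carrier_zmod)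
    moreover have "int n dvd a * b * v $ i" if "a \<in> S (i mod m)" "b \<in> T (i mod m)" for a b
      using that zmod_act_unip_commutator[OF c _ i] assms(5) v
      by (auto simp: S_def T_def acts_abelian_on_def)
    ultimately show "v $ i \<in> K i"
      by (simp add: K_def k_def dvd_Gcd_mult_Gcd)
  qed
  \<comment> \<open>Restricting the coordinate function makes it extensional, so that
    \<open>W\<close> embeds into the finite product of the sets \<open>K i\<close>.\<close>
  let ?c = "\<lambda>v. \<lambda>i\<in>{..<2 * m}. v $ i"
  have "inj_on ?c W"
  proof (rule inj_onI)
    fix v w assume vw: "v \<in> W" "w \<in> W" and eq: "?c v = ?c w"
    have "v $ i = w $ i" if "i < 2 * m" for i
      using fun_cong[OF eq, of i] that by simp
    \<comment> \<open>\<open>W(1)\<close> is stated under the bound on an index;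
      \<open>m > 0\<close> makes the dummy index 0 admissible.\<close>
    moreover have "v \<in> carrier_vec (2 * m)" "w \<in> carrier_vec (2 * m)"
      using W(1)[of _ 0] vw assms(1) by auto
    ultimately show "v = w" by (intro eq_vecI) auto
  qed
  moreover have "?c ` W \<subseteq> Pi\<^sub>E {..<2 * m} K"
    using W(2) by (intro image_subsetI, subst restrict_PiE_iff) auto
  moreover have "finite (Pi\<^sub>E {..<2 * m} K)"
    by (intro finite_PiE) (auto simp: K_def intro: finite_subset[of _ "{0..<int n}"])
  ultimately have "card W \<le> card (Pi\<^sub>E {..<2 * m} K)"
    by (rule card_inj_on_le)
  also have "\<dots> \<le> (\<Prod>i<2 * m. nat (k (i mod m)))"
    unfolding K_def using card_annihilator_le[OF n k_pos] by (simp add: card_PiE prod_mono)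
  also have "\<dots> = ((\<Prod>i<m. nat (Gcd (S i))) * (\<Prod>i<m. nat (Gcd (T i)))) ^ 2"
    unfolding prod_mod_double[of "\<lambda>i. nat (k i)" m]
    by (simp add: k_def nat_mult_distrib prod.distrib)
  also have "\<dots> \<le> (I * I) ^ 2"
    by (intro power_mono mult_mono S_index(2) T_index(2)) auto
  also have "\<dots> = I ^ 4"
    by (simp add: power2_eq_square eval_nat_numeral)
  \<comment> \<open>Since \<open>m > 0\<close>, the exponent 4 is at most \<open>2 + 2 * m\<close>.
    The base is at least 1 because it bounds a product of positive integers.\<close>
  also have "\<dots> \<le> I ^ (2 + 2 * m)"
  proof (rule power_increasing)
    have "0 < (\<Prod>i<m. nat (Gcd (S i)))"
      using S_index(1) by (intro prod_pos) simp
    then show "1 \<le> I" using S_index(2)[of m] by linarith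
  qed (use assms(1) in simp)
  finally have "real (card W) \<le> real I ^ (2 + 2 * m)"
    by (metis of_nat_le_iff of_nat_power)
  also have "\<dots> = real I ^ (2 + 2 * m) * 1" by simp
  also have "\<dots> \<le> real I ^ (2 + 2 * m) * zeta 2 ^ (2 + 2 * m)"
    using zeta_2_ge_1 by (intro mult_left_mono one_le_power) auto
  finally show ?thesis by (simp only: I_def)
qed

end
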